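(* Let $m\ge 3$ and $t\ge s\ge 1$ be integers. Then $$\max\Big\{m,\ st,\ cs-\binom{m-1}{2}\Big\}\le \hat r_{\mathrm{edge}}(mK_2^{\prec},K_{s,t}^{\prec})\le \min\big\{mst,\ m^2+m(s+t-2)+(s-1)(t-1)\big\},$$ where the lower bound holds with $c=t+m-1$ if $t\ge m$, and holds with $c=2m-2$ if $t\le m$. Moreover, the bounds are sharp: there are triples $(m,s,t)$ with $m\ge 3$, $t\ge s\ge 1$ for which the lower bound is attained with equality, and triples for which the upper bound is attained with equality.
   Context: All graphs are finite, simple and undirected. An edge-ordered graph $G^{\prec}$ is a pair $(G,\prec)$ of a graph $G$ and a linear order $\prec$ on $E(G)$. $G^{\prec}$ is an edge-ordered subgraph of $H^{\prec}$ if $G$ is a subgraph of $H$ and the edge order of $G$ is the restriction of the edge order of $H$. Two edge-ordered graphs are isomorphic if there is a graph isomorphism whose induced map on edges preserves the edge orders. An edge-ordered copy of $G^{\prec}$ in $F^{\prec}$ is an edge-ordered subgraph of $F^{\prec}$ isomorphic to $G^{\prec}$. For edge-ordered graphs $G^{\prec},H^{\prec}$, the size edge-ordered Ramsey number $\hat r_{\mathrm{edge}}(G^{\prec},H^{\prec})$ is the minimum number $N$ such that there exists an edge-ordered graph $F^{\prec}$ with $N$ edges such that every red/blue coloring of the edges of $F^{\prec}$ contains a red edge-ordered copy of $G^{\prec}$ or a blue edge-ordered copy of $H^{\prec}$. $mK_2^{\prec}$ is a matching with $m$ edges equipped with a linear order on its edges (all such orders give isomorphic edge-ordered graphs). $K_{s,t}^{\prec}$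 is the complete bipartite graph with partite sets $A=\{u_1,\dots,u_s\}$ and $B=\{v_1,\dots,v_t\}$ and the vertex-lexicographic edge order: $u_iv_j\prec u_kv_l$ iff $i<k$, or $i=k$ and $j<l$ (for $1\le i,k\le s$, $1\le j,l\le t$). *)

theory Defs
  imports Main
begin

record 'v eograph =
  verts :: "'v set"
  edges :: "'v set set"
  eord  :: "('v set \<times> 'v set) set"

text \<open>The edge order is kept as a strict linear order whose field lies inside the edge set.\<close>

definition edge_ordered_graph :: "'v eograph \<Rightarrow> bool" where
  "edge_ordered_graph G \<longleftrightarrow>
     finite (verts G) \<and>
     edges G \<subseteq> {e. e \<subseteq> verts G \<and> card e = 2} \<and>
     eord G \<subseteq> edges G \<times> edges G \<and>
     strict_linear_order_on (edges G) (eord G)"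

definition eo_subgraph :: "'v eograph \<Rightarrow> 'v eograph \<Rightarrow> bool" where
  "eo_subgraph G H \<longleftrightarrow>
     edge_ordered_graph G \<and> edge_ordered_graph H \<and>
     verts G \<subseteq> verts H \<and> edges G \<subseteq> edges H \<and>
     eord G = Restr (eord H) (edges G)"

definition eo_isomorphic :: "'v eograph \<Rightarrow> 'w eograph \<Rightarrow> bool" where
  "eo_isomorphic G H \<longleftrightarrow>
     (\<exists>f. bij_betw f (verts G) (verts H) \<and>
          (\<forall>u\<in>verts G. \<forall>v\<in>verts G. {u, v} \<in> edges G \<longleftrightarrow> {f u, f v} \<in> edges H) \<and>
          (\<forall>e\<in>edges G. \<forall>e'\<in>edges G. (e, e') \<in> eord G \<longleftrightarrow> (f ` e, f ` e') \<in> eord H))"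

definition eo_copy :: "'v eograph \<Rightarrow> 'w eograph \<Rightarrow> 'v eograph \<Rightarrow> bool" where
  "eo_copy C G F \<longleftrightarrow> eo_subgraph C F \<and> eo_isomorphic C G"

datatype colour = Red | Blue

text \<open>Colourings are total functions on vertex sets; only their values on edges matter.\<close>

definition eo_arrows :: "'v eograph \<Rightarrow> 'w eograph \<Rightarrow> 'x eograph \<Rightarrow> bool" where
  "eo_arrows F G H \<longleftrightarrow>
     (\<forall>col :: 'v set \<Rightarrow> colour.
        (\<exists>C. eo_copy C G F \<and> (\<forall>e\<in>edges C. col e = Red)) \<or>
        (\<exists>C. eo_copy C H F \<and> (\<forall>e\<in>edges C. col e = Blue)))"

text \<open>
  As \<open>F\<close> is finite, taking its vertices in \<open>nat\<close> loses no generality. The infimum of a nonempty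
  set of naturals is its minimum; it would be \<open>0\<close> if no suitable \<open>F\<close> existed.
\<close>

definition size_eo_ramsey :: "'v eograph \<Rightarrow> 'w eograph \<Rightarrow> nat" where
  "size_eo_ramsey G H =
     Inf {N. \<exists>F :: nat eograph. edge_ordered_graph F \<and> card (edges F) = N \<and> eo_arrows F G H}"

text \<open>
  Any two linear orders on the edges of a matching give isomorphic edge-ordered graphs, so one
  representative with edges \<open>{2i, 2i+1}\<close>, ordered by \<open>i\<close>, is fixed.
\<close>

definition matching_eo :: "nat \<Rightarrow> nat eograph" where
  "matching_eo m = \<lparr>
     verts = {..<2 * m},
     edges = {{2 * i, 2 * i + 1} | i. i < m},
     eord = {({2 * i, 2 * i + 1}, {2 * k, 2 * k + 1}) | i k. i < k \<and> k < m}\<rparr>"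

text \<open>\<open>Inl i\<close> is the vertex \<open>u\<^sub>i\<close> and \<open>Inr j\<close> is the vertex \<open>v\<^sub>j\<close>.\<close>

definition biclique_eo :: "nat \<Rightarrow> nat \<Rightarrow> (nat + nat) eograph" where
  "biclique_eo s t = \<lparr>
     verts = Inl ` {1..s} \<union> Inr ` {1..t},
     edges = {{Inl i, Inr j} | i j. i \<in> {1..s} \<and> j \<in> {1..t}},
     eord = {({Inl i, Inr j}, {Inl k, Inr l}) | i j k l.
               i \<in> {1..s} \<and> k \<in> {1..s} \<and> j \<in> {1..t} \<and> l \<in> {1..t} \<and>
               (i < k \<or> i = k \<and> j < l)}\<rparr>"

text \<open>Integer-valued because \<open>c s - binom(m-1, 2)\<close> can be negative.\<close>

definition lower_bd :: "nat \<Rightarrow> nat \<Rightarrow> nat \<Rightarrow> nat \<Rightarrow> int" where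
  "lower_bd c m s t =
     Max {int m, int (s * t), int (c * s) - int ((m - 1) choose 2)}"

definition upper_bd :: "nat \<Rightarrow> nat \<Rightarrow> nat \<Rightarrow> int" where
  "upper_bd m s t =
     min (int m * int s * int t)
         ((int m)\<^sup>2 + int m * (int s + int t - 2) + (int s - 1) * (int t - 1))"

lemma edge_ordered_graph_matching_eo: "edge_ordered_graph (matching_eo m)"
proof -
  have inj: "{2 * i, 2 * i + 1} = {2 * k, 2 * k + 1} \<longleftrightarrow> i = k" for i k :: nat
    by (auto simp: doubleton_eq_iff)
  show ?thesis
    unfolding edge_ordered_graph_def matching_eo_def strict_linear_order_on_def
    by (auto simp: inj trans_def irrefl_def total_on_def card_insert_if doubleton_eq_iff) presburger+
qed

lemma edge_ordered_graph_biclique_eo: "edge_ordered_graph (biclique_eo s t)"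
  unfolding edge_ordered_graph_def biclique_eo_def strict_linear_order_on_def
  by (auto simp: trans_def irrefl_def total_on_def card_insert_if doubleton_eq_iff)

end

theory Submission
  imports Defs "HOL-Library.Infinite_Set"
begin

text \<open>
  Everything rests on how far a host can be damaged. If \<open>F\<close> arrows the pair, then deleting any
  \<open>m - 1\<close> vertices leaves a copy of \<open>K\<^sub>s\<^sub>,\<^sub>t\<close>: colour red the edges at the deleted vertices and blue
  the others; a red matching has at most one edge per deleted vertex, so fewer than \<open>m\<close> edges.
  The lower bound follows by deleting well-chosen vertices one at a time. Each graph met along the
  way still contains \<open>K\<^sub>s\<^sub>,\<^sub>t\<close>, hence a vertex of degree at least \<open>t\<close>; deleting that vertex removes
  \<open>t\<close> edges, and the final \<open>K\<^sub>s\<^sub>,\<^sub>t\<close> has \<open>s t\<close> more. So \<open>F\<close> has at least \<open>(m - 1 + s) t\<close> edges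
  (\<open>card_edges_robust_biclique\<close>, \<open>card_edges_arrowing\<close>). As degrees are counted in the graph that is
  left, edges between deleted vertices are not counted twice.
  This one number dominates every term of the stated lower bound. With \<open>n = m - 1\<close>, the only
  inequality that is not immediate, for \<open>c = 2 n\<close>, reduces to \<open>n \<le> (n - s)\<^sup>2 + s\<^sup>2\<close>, which holds
  because an integer is at most its square.

  The second upper bound factors as \<open>(m + s - 1) (m + t - 1)\<close>, the number of edges of a larger
  complete bipartite graph. Given a colouring without a red matching of size \<open>m\<close>, remove the
  vertices of a maximal red matching: each side loses at most \<open>m - 1\<close> vertices, and by maximality
  no red edge survives (\<open>arrows_large_biclique\<close>). The first upper bound comes from \<open>m\<close> disjoint
  copies of \<open>K\<^sub>s\<^sub>,\<^sub>t\<close>: one of them is entirely blue, or each contributes a red edge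
  (\<open>arrows_disjoint_bicliques\<close>).

  To handle edge orders uniformly, both hosts have vertices in \<open>nat\<close> and edges ordered
  lexicographically by smaller, then larger endpoint. In such a graph, any complete bipartite piece
  whose one side lies below the other carries the vertex-lexicographic order, and any pairwise
  disjoint edges form a copy of the ordered matching, so only unordered structure has to be found.

  For \<open>m = 3\<close> and \<open>s = t = 1\<close> both bounds equal \<open>3\<close>, which gives both sharpness claims.
\<close>

section \<open>Isomorphisms\<close>

text \<open>
  For disjoint \<open>A\<close> and \<open>B\<close> these are the edges of the complete bipartite graph with sides \<open>A\<close> and
  \<open>B\<close>. A bare edge set, rather than a graph, serves for patterns, hosts and copies alike.
\<close>
definition cross :: "'v set \<Rightarrow> 'v set \<Rightarrow> 'v set set" where
  "cross A B = (\<lambda>(x, y). {x, y}) ` (A \<times> B)"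

lemma image_cross: "(`) h ` cross A B = cross (h ` A) (h ` B)"
proof -
  have "(`) h ` cross A B = (\<lambda>(x, y). {h x, h y}) ` (A \<times> B)"
    by (simp add: cross_def image_image case_prod_unfold)
  also have "\<dots> = cross (h ` A) (h ` B)" unfolding cross_def by force
  finally show ?thesis .
qed

lemma edges_biclique_eo: "edges (biclique_eo s t) = cross (Inl ` {1..s}) (Inr ` {1..t})"
  unfolding biclique_eo_def cross_def by force

text \<open>
  Copies are built by embedding the pattern, so the map goes from the pattern \<open>G\<close> to the copy \<open>C\<close>,
  against the direction in \<open>eo_isomorphic\<close>. Preserving the order in one direction suffices: the
  order of \<open>G\<close> is total and that of \<open>C\<close> is asymmetric.
\<close>
lemma eo_isomorphicI:
  assumes G: "edge_ordered_graph G" and C: "edge_ordered_graph C"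
    and h: "bij_betw h (verts G) (verts C)"
    and edges: "edges C = (`) h ` edges G"
    and ord: "\<And>e e'. (e, e') \<in> eord G \<Longrightarrow> (h ` e, h ` e') \<in> eord C"
  shows "eo_isomorphic C G"
proof -
  define f where "f = inv_into (verts G) h"
  have f: "bij_betw f (verts C) (verts G)"
    unfolding f_def by (rule bij_betw_inv_into[OF h])
  have inj: "inj_on h (verts G)" using h by (rule bij_betw_imp_inj_on)
  have sub: "e \<subseteq> verts G" if "e \<in> edges G" for e
    using G that unfolding edge_ordered_graph_def by auto
  have fh: "f ` h ` e = e" if "e \<subseteq> verts G" for e
    unfolding f_def using inj that by (rule inv_into_image_cancel)
  have hf: "h (f u) = u" if "u \<in> verts C" for u
    unfolding f_def using h that by (rule bij_betw_inv_into_right)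
  have ordG: "trans (eord G)" "irrefl (eord G)" "total_on (edges G) (eord G)"
    and ordC: "trans (eord C)" "irrefl (eord C)"
    using G C unfolding edge_ordered_graph_def strict_linear_order_on_def by auto
  have "{u, v} \<in> edges C \<longleftrightarrow> {f u, f v} \<in> edges G" if "u \<in> verts C" "v \<in> verts C" for u v
  proof
    assume "{u, v} \<in> edges C"
    then obtain e where e: "e \<in> edges G" "{u, v} = h ` e" using edges by auto
    then have "f ` {u, v} = e" using fh sub by metis
    then have "{f u, f v} = e" by simp
    then show "{f u, f v} \<in> edges G" using e by simp
  next
    assume "{f u, f v} \<in> edges G"
    then have "h ` {f u, f v} \<in> edges C" using edges by blast
    then show "{u, v} \<in> edges C" using hf that by simp
  qed
  moreover have "(e, e') \<in> eord C \<longleftrightarrow> (f ` e, f ` e') \<in> eord G"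
    if e: "e \<in> edges C" "e' \<in> edges C" for e e'
  proof -
    obtain d where d: "d \<in> edges G" "e = h ` d" using e(1) unfolding edges by (rule imageE)
    obtain d' where d': "d' \<in> edges G" "e' = h ` d'" using e(2) unfolding edges by (rule imageE)
    have "(d, d') \<in> eord G" if "(h ` d, h ` d') \<in> eord C"
    proof (rule ccontr)
      assume "(d, d') \<notin> eord G"
      then have "d = d' \<or> (d', d) \<in> eord G"
        using ordG(3) d d' unfolding total_on_def by blast
      then show False using ord that ordC unfolding irrefl_def trans_def by blast
    qed
    then show ?thesis using d d' fh sub ord by metis
  qed
  ultimately show ?thesis unfolding eo_isomorphic_def using f by blast
qed

lemma biclique_iso_cross:
  assumes "eo_isomorphic C (biclique_eo s t)"
  obtains A B where "finite A" "finite B" "card A = s" "card B = t" "A \<inter> B = {}"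
    "cross A B \<subseteq> edges C"
proof -
  obtain f where f: "bij_betw f (verts C) (verts (biclique_eo s t))"
    and edge: "\<And>u v. u \<in> verts C \<Longrightarrow> v \<in> verts C \<Longrightarrow>
      {u, v} \<in> edges C \<longleftrightarrow> {f u, f v} \<in> edges (biclique_eo s t)"
    using assms unfolding eo_isomorphic_def by blast
  define h where "h = inv_into (verts C) f"
  have h: "bij_betw h (verts (biclique_eo s t)) (verts C)"
    unfolding h_def by (rule bij_betw_inv_into[OF f])
  have fh: "f (h x) = x" if "x \<in> verts (biclique_eo s t)" for x
    unfolding h_def using f that by (rule bij_betw_inv_into_right)
  have V: "verts (biclique_eo s t) = Inl ` {1..s} \<union> Inr ` {1..t}"
    by (simp add: biclique_eo_def)
  have inj: "inj_on h (Inl ` {1..s} \<union> Inr ` {1..t})"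
    using bij_betw_imp_inj_on[OF h] V by simp
  have img: "h x \<in> verts C" if "x \<in> verts (biclique_eo s t)" for x
    using h that by (auto simp: bij_betw_def)
  let ?A = "h ` Inl ` {1..s}" and ?B = "h ` Inr ` {1..t}"
  have "card ?A = s" "card ?B = t"
    using inj by (auto simp: card_image inj_on_Un)
  moreover have "?A \<inter> ?B = {}"
    using inj unfolding inj_on_Un by blast
  moreover have "cross ?A ?B \<subseteq> edges C"
  proof -
    have "{h (Inl i), h (Inr j)} \<in> edges C" if "i \<in> {1..s}" "j \<in> {1..t}" for i j
    proof -
      have x: "Inl i \<in> verts (biclique_eo s t)" "Inr j \<in> verts (biclique_eo s t)"
        using that V by auto
      have "{Inl i, Inr j} \<in> edges (biclique_eo s t)"
        using that unfolding biclique_eo_def by auto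
      then show ?thesis using edge[OF img[OF x(1)] img[OF x(2)]] fh x by simp
    qed
    then show ?thesis unfolding cross_def by auto
  qed
  ultimately show thesis by (intro that[of ?A ?B]) auto
qed

text \<open>
  Each vertex lies on just one edge of the matching, so covering \<open>m\<close> edges takes \<open>m\<close> vertices: the
  map \<open>w \<mapsto> f w div 2\<close> sends a covering vertex to the index of its edge.
\<close>
lemma matching_iso_cover:
  assumes "eo_isomorphic C (matching_eo m)" and "finite W"
    and cover: "\<And>e. e \<in> edges C \<Longrightarrow> e \<inter> W \<noteq> {}"
  shows "m \<le> card W"
proof -
  obtain f where f: "bij_betw f (verts C) (verts (matching_eo m))"
    and edge: "\<And>u v. u \<in> verts C \<Longrightarrow> v \<in> verts C \<Longrightarrow>
      {u, v} \<in> edges C \<longleftrightarrow> {f u, f v} \<in> edges (matching_eo m)"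
    using assms(1) unfolding eo_isomorphic_def by blast
  have V: "verts (matching_eo m) = {..<2 * m}" by (simp add: matching_eo_def)
  have "i \<in> (\<lambda>w. f w div 2) ` W" if i: "i < m" for i
  proof -
    have "2 * i \<in> f ` verts C" "2 * i + 1 \<in> f ` verts C"
      using bij_betw_imp_surj_on[OF f] V i by auto
    then obtain u v where uv: "u \<in> verts C" "v \<in> verts C" "f u = 2 * i" "f v = 2 * i + 1"
      by (metis imageE)
    have "{f u, f v} \<in> edges (matching_eo m)"
      using i uv unfolding matching_eo_def by auto
    then have "{u, v} \<inter> W \<noteq> {}" using edge uv cover by metis
    moreover have "f u div 2 = i" "f v div 2 = i" using uv by auto
    ultimately obtain w where "w \<in> W" "f w div 2 = i" by blast
    then show ?thesis by blast
  qed
  then have "{..<m} \<subseteq> (\<lambda>w. f w div 2) ` W" by auto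
  then have "card {..<m} \<le> card W" using assms(2) by (rule surj_card_le[rotated])
  then show ?thesis by simp
qed

section \<open>The lower bound\<close>

lemma card_cross:
  assumes "A \<inter> B = {}"
  shows "card (cross A B) = card A * card B"
proof -
  have "inj_on (\<lambda>(x, y). {x, y}) (A \<times> B)"
    using assms by (auto simp: inj_on_def doubleton_eq_iff)
  then show ?thesis unfolding cross_def by (simp add: card_image card_cartesian_product)
qed

text \<open>
  Induction on the number \<open>k\<close> of deletable vertices. A vertex \<open>v\<close> on the side \<open>A\<close> of a complete
  bipartite subgraph has degree at least \<open>t\<close>, and without it the graph still withstands the
  deletion of any \<open>k - 1\<close> vertices.
\<close>
lemma card_edges_robust_biclique:
  assumes "finite E" and "1 \<le> s"
    and "\<And>W. finite W \<Longrightarrow> card W \<le> k \<Longrightarrow>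
      \<exists>A B. finite A \<and> finite B \<and> card A = s \<and> card B = t \<and> A \<inter> B = {} \<and>
        cross A B \<subseteq> {e \<in> E. e \<inter> W = {}}"
  shows "(k + s) * t \<le> card E"
  using assms
proof (induction k arbitrary: E)
  case 0
  obtain A B where AB: "card A = s" "card B = t" "A \<inter> B = {}" "cross A B \<subseteq> E"
    using "0.prems"(3)[of "{}"] by auto
  then have "card (cross A B) = s * t" by (simp add: card_cross)
  then show ?case using card_mono[OF "0.prems"(1) AB(4)] by simp
next
  case (Suc k)
  obtain A B where AB: "card A = s" "card B = t" "A \<inter> B = {}" "cross A B \<subseteq> E"
    using Suc.prems(3)[of "{}"] by auto
  then obtain v where v: "v \<in> A" using \<open>1 \<le> s\<close> by fastforce
  define E' where "E' = {e \<in> E. v \<notin> e}"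
  have "(k + s) * t \<le> card E'"
  proof (rule Suc.IH)
    show "finite E'" "1 \<le> s" using Suc.prems E'_def by auto
    fix W :: "'a set" assume W: "finite W" "card W \<le> k"
    then have "card (insert v W) \<le> Suc k" by (simp add: card_insert_if)
    moreover have "{e \<in> E. e \<inter> insert v W = {}} = {e \<in> E'. e \<inter> W = {}}"
      unfolding E'_def by auto
    ultimately show "\<exists>A B. finite A \<and> finite B \<and> card A = s \<and> card B = t \<and> A \<inter> B = {} \<and>
        cross A B \<subseteq> {e \<in> E'. e \<inter> W = {}}"
      using Suc.prems(3)[of "insert v W"] W by simp
  qed
  moreover have "card (cross {v} B) = t"
    using v AB by (subst card_cross) auto
  moreover have "card (cross {v} B) + card E' \<le> card E"
  proof -
    have "cross {v} B \<subseteq> E" using v AB(4) unfolding cross_def by auto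
    moreover have "cross {v} B \<inter> E' = {}" unfolding cross_def E'_def by auto
    moreover have "E' \<subseteq> E" unfolding E'_def by auto
    ultimately show ?thesis using Suc.prems(1)
      by (metis Un_least card_Un_disjoint card_mono finite_subset)
  qed
  ultimately show ?case by simp
qed

lemma finite_edges:
  assumes "edge_ordered_graph F"
  shows "finite (edges F)"
proof (rule finite_subset)
  show "edges F \<subseteq> Pow (verts F)" "finite (Pow (verts F))"
    using assms unfolding edge_ordered_graph_def by auto
qed

lemma card_edges_arrowing:
  assumes F: "edge_ordered_graph F" and arr: "eo_arrows F (matching_eo m) (biclique_eo s t)"
    and "1 \<le> m" "1 \<le> s"
  shows "(m - 1 + s) * t \<le> card (edges F)"
proof (rule card_edges_robust_biclique[OF finite_edges[OF F] \<open>1 \<le> s\<close>])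
  fix W :: "'a set" assume W: "finite W" "card W \<le> m - 1"
  define col where "col e = (if e \<inter> W = {} then Blue else Red)" for e
  have "\<not> (\<exists>C. eo_copy C (matching_eo m) F \<and> (\<forall>e\<in>edges C. col e = Red))"
  proof
    assume "\<exists>C. eo_copy C (matching_eo m) F \<and> (\<forall>e\<in>edges C. col e = Red)"
    then obtain C where C: "eo_isomorphic C (matching_eo m)" "\<forall>e\<in>edges C. col e = Red"
      unfolding eo_copy_def by blast
    have "m \<le> card W"
    proof (rule matching_iso_cover[OF C(1) W(1)])
      show "e \<inter> W \<noteq> {}" if "e \<in> edges C" for e
        using C(2) that unfolding col_def by (metis colour.distinct(1))
    qed
    then show False using W(2) \<open>1 \<le> m\<close> by simp
  qed
  then obtain C where C: "eo_copy C (biclique_eo s t) F" "\<forall>e\<in>edges C. col e = Blue"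
    using arr unfolding eo_arrows_def by blast
  have "edges C \<subseteq> {e \<in> edges F. e \<inter> W = {}}"
    using C unfolding eo_copy_def eo_subgraph_def col_def
    by (auto split: if_splits)
  moreover obtain A B where "finite A" "finite B" "card A = s" "card B = t" "A \<inter> B = {}"
    "cross A B \<subseteq> edges C"
    using C(1) biclique_iso_cross unfolding eo_copy_def by metis
  ultimately show "\<exists>A B. finite A \<and> finite B \<and> card A = s \<and> card B = t \<and> A \<inter> B = {} \<and>
        cross A B \<subseteq> {e \<in> edges F. e \<inter> W = {}}"
    by blast
qed

section \<open>Lexicographically ordered graphs\<close>

text \<open>
  Taking exactly the endpoints as vertices makes every subset of the edges determine a subgraph, so
  that copies can be named by their edge sets.
\<close>
definition lex_graph :: "nat set set \<Rightarrow> nat eograph" where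
  "lex_graph E = \<lparr>
     verts = \<Union>E,
     edges = E,
     eord = {(e, e'). e \<in> E \<and> e' \<in> E \<and>
       (Min e < Min e' \<or> Min e = Min e' \<and> Max e < Max e')}\<rparr>"

lemma lex_graph_sel [simp]:
  "verts (lex_graph E) = \<Union>E" "edges (lex_graph E) = E"
  by (simp_all add: lex_graph_def)

lemma edge_Min_Max:
  fixes e :: "nat set"
  assumes "card e = 2"
  shows "e = {Min e, Max e}" "Min e < Max e"
proof -
  obtain x y where "e = {x, y}" "x \<noteq> y" using assms by (auto simp: card_2_iff)
  then show "e = {Min e, Max e}" "Min e < Max e" by (auto simp: min_def max_def)
qed

lemma edge_ordered_lex_graph:
  assumes fin: "finite E" and two: "\<And>e. e \<in> E \<Longrightarrow> card e = 2"
  shows "edge_ordered_graph (lex_graph E)"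
proof -
  have "finite (\<Union>E)"
    using fin two by (metis card.infinite finite_Union zero_neq_numeral)
  moreover have "total_on E (eord (lex_graph E))"
  proof (rule total_onI)
    fix e e' assume e: "e \<in> E" "e' \<in> E" "e \<noteq> e'"
    then have "Min e \<noteq> Min e' \<or> Max e \<noteq> Max e'"
      using edge_Min_Max(1)[OF two] by metis
    then show "(e, e') \<in> eord (lex_graph E) \<or> (e', e) \<in> eord (lex_graph E)"
      using e by (auto simp: lex_graph_def)
  qed
  ultimately show ?thesis
    unfolding edge_ordered_graph_def strict_linear_order_on_def using two
    by (auto simp: lex_graph_def trans_def irrefl_def)
qed

lemma eo_copy_lex_graph:
  assumes E: "finite E" "\<And>e. e \<in> E \<Longrightarrow> card e = 2" and "D \<subseteq> E"
    and G: "edge_ordered_graph G"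
    and h: "bij_betw h (verts G) (\<Union>D)" and D: "D = (`) h ` edges G"
    and ord: "\<And>e e'. (e, e') \<in> eord G \<Longrightarrow>
      Min (h ` e) < Min (h ` e') \<or> Min (h ` e) = Min (h ` e') \<and> Max (h ` e) < Max (h ` e')"
  shows "eo_copy (lex_graph D) G (lex_graph E)"
proof -
  have eoD: "edge_ordered_graph (lex_graph D)"
    using E \<open>D \<subseteq> E\<close> by (intro edge_ordered_lex_graph) (auto intro: finite_subset)
  have "eo_subgraph (lex_graph D) (lex_graph E)"
    unfolding eo_subgraph_def using eoD edge_ordered_lex_graph[OF E] \<open>D \<subseteq> E\<close>
    by (auto simp: lex_graph_def)
  moreover have "eo_isomorphic (lex_graph D) G"
  proof (rule eo_isomorphicI[OF G eoD])
    fix e e' assume e: "(e, e') \<in> eord G"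
    then have "e \<in> edges G" "e' \<in> edges G"
      using G unfolding edge_ordered_graph_def by auto
    then show "(h ` e, h ` e') \<in> eord (lex_graph D)"
      using ord[OF e] D by (auto simp: lex_graph_def)
  qed (use h D in simp_all)
  ultimately show ?thesis unfolding eo_copy_def by blast
qed

text \<open>
  Placing all of \<open>A\<close> below all of \<open>B\<close> makes \<open>Min\<close> and \<open>Max\<close> of an edge its endpoints in \<open>A\<close> and \<open>B\<close>,
  so that the host's order restricts to the vertex-lexicographic one once both sides are enumerated
  increasingly.
\<close>
lemma eo_copy_biclique:
  assumes E: "finite E" "\<And>e. e \<in> E \<Longrightarrow> card e = 2"
    and AB: "finite A" "finite B" "A \<noteq> {}" "B \<noteq> {}" "cross A B \<subseteq> E"
    and less: "\<And>a b. a \<in> A \<Longrightarrow> b \<in> B \<Longrightarrow> a < b"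
  shows "eo_copy (lex_graph (cross A B)) (biclique_eo (card A) (card B)) (lex_graph E)"
proof -
  let ?G = "biclique_eo (card A) (card B)"
  obtain x where x: "bij_betw x {..<card A} A" "strict_mono_on {..<card A} x"
    using ex_bij_betw_strict_mono_card[OF AB(1)] by blast
  obtain y where y: "bij_betw y {..<card B} B" "strict_mono_on {..<card B} y"
    using ex_bij_betw_strict_mono_card[OF AB(2)] by blast
  \<comment> \<open>The vertices of \<open>biclique_eo\<close> are numbered from \<open>1\<close>, the enumerations from \<open>0\<close>.\<close>
  define h where "h v = (case v of Inl i \<Rightarrow> x (i - 1) | Inr j \<Rightarrow> y (j - 1))" for v :: "nat + nat"
  have shift: "bij_betw (\<lambda>i. i - 1) {1..n} {..<n}" for n :: nat
    by (rule bij_betw_byWitness[where f' = Suc]) auto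
  have surj: "h ` Inl ` {1..card A} = A" "h ` Inr ` {1..card B} = B"
    using bij_betw_imp_surj_on[OF bij_betw_trans[OF shift x(1)]]
      bij_betw_imp_surj_on[OF bij_betw_trans[OF shift y(1)]]
    by (auto simp: h_def image_image)
  have hA: "h (Inl i) \<in> A" if "i \<in> {1..card A}" for i using surj that by blast
  have hB: "h (Inr j) \<in> B" if "j \<in> {1..card B}" for j using surj that by blast
  have hx: "h (Inl i) < h (Inl k)" if "i \<in> {1..card A}" "k \<in> {1..card A}" "i < k" for i k
    unfolding h_def using that by (auto intro!: strict_mono_onD[OF x(2)])
  have hy: "h (Inr i) < h (Inr k)" if "i \<in> {1..card B}" "k \<in> {1..card B}" "i < k" for i k
    unfolding h_def using that by (auto intro!: strict_mono_onD[OF y(2)])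
  have Un: "\<Union>(cross A B) = A \<union> B"
    using AB by (auto simp: cross_def)
  show ?thesis
  proof (rule eo_copy_lex_graph[OF E AB(5) edge_ordered_graph_biclique_eo])
    have "inj_on h (verts ?G)"
    proof (rule inj_onI)
      fix v w assume vw: "v \<in> verts ?G" "w \<in> verts ?G" "h v = h w"
      show "v = w"
      proof (cases v; cases w)
        fix i k assume "v = Inl i" "w = Inl k"
        then show ?thesis using vw hx[of i k] hx[of k i]
          by (cases i k rule: linorder_cases) (auto simp: biclique_eo_def)
      next
        fix i k assume "v = Inr i" "w = Inr k"
        then show ?thesis using vw hy[of i k] hy[of k i]
          by (cases i k rule: linorder_cases) (auto simp: biclique_eo_def)
      next
        fix i k assume "v = Inl i" "w = Inr k"
        then show ?thesis using vw less[OF hA hB, of i k] by (auto simp: biclique_eo_def)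
      next
        fix i k assume "v = Inr i" "w = Inl k"
        then show ?thesis using vw less[OF hA hB, of k i] by (auto simp: biclique_eo_def)
      qed
    qed
    moreover have "h ` verts ?G = A \<union> B"
      unfolding biclique_eo_def using surj by (simp add: image_Un)
    ultimately show "bij_betw h (verts ?G) (\<Union>(cross A B))"
      by (simp add: bij_betw_def Un)
    have "cross A B = cross (h ` Inl ` {1..card A}) (h ` Inr ` {1..card B})"
      by (simp only: surj)
    also have "\<dots> = (`) h ` edges ?G"
      by (simp only: edges_biclique_eo image_cross)
    finally show "cross A B = (`) h ` edges ?G" .
  next
    fix e e' assume "(e, e') \<in> eord ?G"
    then obtain i j k l where e: "e = {Inl i, Inr j}" "e' = {Inl k, Inr l}"
      and in_range: "i \<in> {1..card A}" "k \<in> {1..card A}" "j \<in> {1..card B}" "l \<in> {1..card B}"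
      and lt: "i < k \<or> i = k \<and> j < l"
      unfolding biclique_eo_def by auto
    have "Min (h ` e) = h (Inl i)" "Max (h ` e) = h (Inr j)"
      "Min (h ` e') = h (Inl k)" "Max (h ` e') = h (Inr l)"
      using less[OF hA hB] in_range e by (auto simp: min_def max_def not_le order_less_imp_le)
    then show "Min (h ` e) < Min (h ` e') \<or> Min (h ` e) = Min (h ` e') \<and> Max (h ` e) < Max (h ` e')"
      using lt hx hy in_range by auto
  qed
qed

text \<open>
  Disjoint edges have different minima, so their order is that of the minima; enumerating the
  minima increasingly enumerates the edges in the order of the matching.
\<close>
lemma eo_copy_matching:
  assumes E: "finite E" "\<And>e. e \<in> E \<Longrightarrow> card e = 2"
    and M: "M \<subseteq> E" "pairwise disjnt M"
  shows "eo_copy (lex_graph M) (matching_eo (card M)) (lex_graph E)"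
proof -
  let ?m = "card M"
  have M2: "card e = 2" if "e \<in> M" for e using that M(1) E(2) by auto
  have finM: "finite M" using M E finite_subset by blast
  have inE: "Min e \<in> e" "Max e \<in> e" if "e \<in> M" for e
    using edge_Min_Max(1)[OF M2[OF that]] by blast+
  have same: "e = e'" if "e \<in> M" "e' \<in> M" "v \<in> e" "v \<in> e'" for e e' v
    using M(2) that unfolding pairwise_def disjnt_def by blast
  have injMin: "inj_on Min M"
    by (rule inj_onI) (metis same inE(1))
  obtain x where x: "bij_betw x {..<?m} (Min ` M)" "strict_mono_on {..<?m} x"
    using ex_bij_betw_strict_mono_card[of "Min ` M"] finM card_image[OF injMin] by auto
  \<comment> \<open>The \<open>i\<close>-th edge of \<open>M\<close>, counted from \<open>0\<close> as in \<open>matching_eo\<close>.\<close>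
  define d where "d i = inv_into M Min (x i)" for i
  have dbij: "bij_betw d {..<?m} M"
    using bij_betw_trans[OF x(1) bij_betw_inv_into[OF inj_on_imp_bij_betw[OF injMin]]]
    by (simp add: d_def[abs_def] comp_def)
  have dM: "d i \<in> M" if "i < ?m" for i using dbij that by (auto simp: bij_betw_def)
  have dx: "Min (d i) = x i" if "i < ?m" for i
    unfolding d_def using x(1) that by (intro f_inv_into_f) (auto simp: bij_betw_def)
  define h where "h n = (if even n then Min (d (n div 2)) else Max (d (n div 2)))" for n
  have hin: "h n \<in> d (n div 2)" if "n < 2 * ?m" for n
    using inE[OF dM[of "n div 2"]] that by (auto simp: h_def)
  have hd: "h ` {2 * i, 2 * i + 1} = d i" if "i < ?m" for i
    using edge_Min_Max(1)[OF M2[OF dM[OF that]]] by (auto simp: h_def)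
  show ?thesis
  proof (rule eo_copy_lex_graph[OF E M(1) edge_ordered_graph_matching_eo])
    have edges: "edges (matching_eo ?m) = (\<lambda>i. {2 * i, 2 * i + 1}) ` {..<?m}"
      by (auto simp: matching_eo_def)
    have "M = d ` {..<?m}" using dbij by (simp add: bij_betw_def)
    also have "\<dots> = (`) h ` edges (matching_eo ?m)"
      unfolding edges image_image using hd by (intro image_cong) auto
    finally show M_eq: "M = (`) h ` edges (matching_eo ?m)" .
    have "\<Union>(edges (matching_eo ?m)) = {..<2 * ?m}"
    proof
      show "{..<2 * ?m} \<subseteq> \<Union>(edges (matching_eo ?m))"
      proof
        fix n assume "n \<in> {..<2 * ?m}"
        then have "n div 2 < ?m" "n \<in> {2 * (n div 2), 2 * (n div 2) + 1}" by auto
        then show "n \<in> \<Union>(edges (matching_eo ?m))" unfolding edges by blast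
      qed
    qed (auto simp: edges)
    then have "h ` {..<2 * ?m} = \<Union>((`) h ` edges (matching_eo ?m))"
      by (metis image_Union)
    also have "\<dots> = \<Union>M" by (rule arg_cong[OF M_eq[symmetric]])
    finally have "h ` {..<2 * ?m} = \<Union>M" .
    moreover have "inj_on h {..<2 * ?m}"
    proof (rule inj_onI)
      fix n k assume nk: "n \<in> {..<2 * ?m}" "k \<in> {..<2 * ?m}" "h n = h k"
      then have lt: "n div 2 < ?m" "k div 2 < ?m" by auto
      have "d (n div 2) = d (k div 2)"
        using same[OF dM[OF lt(1)] dM[OF lt(2)], of "h n"] hin[of n] hin[of k] nk by simp
      then have eq: "n div 2 = k div 2"
        using lt dbij by (auto simp: bij_betw_def inj_on_def)
      have "even n = even k"
        using nk(3) edge_Min_Max(2)[OF M2[OF dM[OF lt(1)]]] eq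
        by (auto simp: h_def split: if_splits)
      then show "n = k" using eq by (metis dvd_mult_div_cancel odd_two_times_div_two_succ)
    qed
    ultimately show "bij_betw h (verts (matching_eo ?m)) (\<Union>M)"
      by (simp add: bij_betw_def matching_eo_def)
  next
    fix e e' assume "(e, e') \<in> eord (matching_eo ?m)"
    then obtain i k where "e = {2 * i, 2 * i + 1}" "e' = {2 * k, 2 * k + 1}" "i < k" "k < ?m"
      unfolding matching_eo_def by auto
    then have "Min (h ` e) < Min (h ` e')"
      using hd dx x(2) by (simp del: image_insert add: strict_mono_on_def)
    then show "Min (h ` e) < Min (h ` e') \<or> Min (h ` e) = Min (h ` e') \<and> Max (h ` e) < Max (h ` e')"
      by simp
  qed
qed

section \<open>The upper bounds\<close>

lemma size_eo_ramsey_le: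
  fixes F :: "nat eograph"
  assumes "edge_ordered_graph F" "eo_arrows F G H"
  shows "size_eo_ramsey G H \<le> card (edges F)"
  unfolding size_eo_ramsey_def using assms by (intro cInf_lower) auto

lemma finite_cross [simp]: "finite A \<Longrightarrow> finite B \<Longrightarrow> finite (cross A B)"
  by (simp add: cross_def)

lemma card_edge_cross:
  assumes "e \<in> cross A B" "A \<inter> B = {}"
  shows "card e = 2"
  using assms by (auto simp: cross_def card_insert_if)

text \<open>
  If no piece is entirely blue, choosing a red edge in each piece gives \<open>m\<close> disjoint red edges.
\<close>
lemma arrows_disjoint_bicliques:
  fixes A B :: "nat \<Rightarrow> nat set"
  assumes fin: "\<And>p. p < m \<Longrightarrow> finite (A p) \<and> finite (B p)"
    and card: "\<And>p. p < m \<Longrightarrow> card (A p) = s \<and> card (B p) = t"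
    and st: "1 \<le> s" "1 \<le> t"
    and less: "\<And>p a b. p < m \<Longrightarrow> a \<in> A p \<Longrightarrow> b \<in> B p \<Longrightarrow> a < b"
    and disj: "\<And>p q. p < m \<Longrightarrow> q < m \<Longrightarrow> p \<noteq> q \<Longrightarrow> (A p \<union> B p) \<inter> (A q \<union> B q) = {}"
  defines "E \<equiv> \<Union>p<m. cross (A p) (B p)"
  shows "edge_ordered_graph (lex_graph E)"
    and "eo_arrows (lex_graph E) (matching_eo m) (biclique_eo s t)"
proof -
  have E: "finite E" using fin by (auto simp: E_def)
  have AB: "A p \<inter> B p = {}" if "p < m" for p using less[OF that] by fastforce
  have E2: "card e = 2" if "e \<in> E" for e
    using that AB card_edge_cross unfolding E_def by blast
  show "edge_ordered_graph (lex_graph E)" using E E2 by (rule edge_ordered_lex_graph)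
  show "eo_arrows (lex_graph E) (matching_eo m) (biclique_eo s t)"
    unfolding eo_arrows_def
  proof
    fix col :: "nat set \<Rightarrow> colour"
    show "(\<exists>C. eo_copy C (matching_eo m) (lex_graph E) \<and> (\<forall>e\<in>edges C. col e = Red)) \<or>
      (\<exists>C. eo_copy C (biclique_eo s t) (lex_graph E) \<and> (\<forall>e\<in>edges C. col e = Blue))"
    proof (cases "\<exists>p<m. \<forall>e\<in>cross (A p) (B p). col e = Blue")
      case True
      then obtain p where p: "p < m" "\<forall>e\<in>cross (A p) (B p). col e = Blue" by blast
      have "A p \<noteq> {}" "B p \<noteq> {}" using card[OF p(1)] st by auto
      then have "eo_copy (lex_graph (cross (A p) (B p)))
          (biclique_eo (card (A p)) (card (B p))) (lex_graph E)"
        using p(1) fin less E E2 by (intro eo_copy_biclique) (auto simp: E_def)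
      then show ?thesis using p card by auto
    next
      case False
      then have "\<forall>p<m. \<exists>e. e \<in> cross (A p) (B p) \<and> col e = Red"
        by (metis colour.exhaust)
      then obtain e where e: "\<And>p. p < m \<Longrightarrow> e p \<in> cross (A p) (B p) \<and> col (e p) = Red"
        by metis
      let ?M = "e ` {..<m}"
      have esub: "e p \<subseteq> A p \<union> B p" "e p \<noteq> {}" if "p < m" for p
        using e[OF that] by (auto simp: cross_def)
      have edisj: "e p \<inter> e q = {}" if "p < m" "q < m" "p \<noteq> q" for p q
        using esub(1)[OF that(1)] esub(1)[OF that(2)] disj[OF that] by blast
      have "inj_on e {..<m}"
      proof (rule inj_onI, rule ccontr)
        fix p q assume "p \<in> {..<m}" "q \<in> {..<m}" "e p = e q" "p \<noteq> q"
        then show False using edisj[of p q] esub(2)[of p] by simp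
      qed
      then have "card ?M = m" by (simp add: card_image)
      moreover have "pairwise disjnt ?M"
        using edisj by (auto simp: pairwise_def disjnt_def)
      moreover have "?M \<subseteq> E" using e by (auto simp: E_def)
      ultimately have "eo_copy (lex_graph ?M) (matching_eo m) (lex_graph E)"
        using eo_copy_matching[OF E E2, of ?M] by simp
      then show ?thesis using e by (intro disjI1 exI[of _ "lex_graph ?M"]) auto
    qed
  qed
qed

lemma size_eo_ramsey_le_copies:
  assumes "1 \<le> s" "1 \<le> t"
  shows "size_eo_ramsey (matching_eo m) (biclique_eo s t) \<le> m * (s * t)"
proof -
  define A where "A p = {p * (s + t)..<p * (s + t) + s}" for p
  define B where "B p = {p * (s + t) + s..<p * (s + t) + s + t}" for p
  let ?E = "\<Union>p<m. cross (A p) (B p)"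
  \<comment> \<open>Copy \<open>p\<close> occupies the \<open>p\<close>-th block of \<open>s + t\<close> consecutive numbers.\<close>
  have range: "x div (s + t) = p" if "x \<in> A p \<union> B p" for x p
  proof -
    from that have "p * (s + t) \<le> x" "x < Suc p * (s + t)" by (auto simp: A_def B_def)
    then show ?thesis by (metis div_nat_eqI mult.commute)
  qed
  have arr: "edge_ordered_graph (lex_graph ?E)"
    "eo_arrows (lex_graph ?E) (matching_eo m) (biclique_eo s t)"
  proof -
    have disj: "(A p \<union> B p) \<inter> (A q \<union> B q) = {}" if "p \<noteq> q" for p q
      using range that by blast
    show "edge_ordered_graph (lex_graph ?E)"
      "eo_arrows (lex_graph ?E) (matching_eo m) (biclique_eo s t)"
      by (rule arrows_disjoint_bicliques[where s = s and t = t];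
          use disj assms in \<open>auto simp: A_def B_def\<close>)+
  qed
  have "card ?E \<le> (\<Sum>p<m. card (cross (A p) (B p)))" by (rule card_UN_le) simp
  also have "\<dots> = m * (s * t)"
    by (simp add: card_cross A_def B_def)
  finally show ?thesis using size_eo_ramsey_le[OF arr] by simp
qed

text \<open>
  A maximal red matching with fewer than \<open>m\<close> edges has at most \<open>m - 1\<close> endpoints on each side.
  Outside its endpoints at least \<open>s\<close> and \<open>t\<close> vertices remain, and any red edge between them could
  be added to the matching.
\<close>
lemma arrows_large_biclique:
  fixes A B :: "nat set"
  assumes fin: "finite A" "finite B" and card: "m - 1 + s \<le> card A" "m - 1 + t \<le> card B"
    and st: "1 \<le> s" "1 \<le> t"
    and less: "\<And>a b. a \<in> A \<Longrightarrow> b \<in> B \<Longrightarrow> a < b"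
  shows "eo_arrows (lex_graph (cross A B)) (matching_eo m) (biclique_eo s t)"
  unfolding eo_arrows_def
proof
  fix col :: "nat set \<Rightarrow> colour"
  let ?E = "cross A B"
  have AB: "A \<inter> B = {}" using less by fastforce
  have E: "finite ?E" using fin by simp
  have E2: "card e = 2" if "e \<in> ?E" for e using that AB by (rule card_edge_cross)
  let ?match = "\<lambda>M. M \<subseteq> {e \<in> ?E. col e = Red} \<and> pairwise disjnt M"
  show "(\<exists>C. eo_copy C (matching_eo m) (lex_graph ?E) \<and> (\<forall>e\<in>edges C. col e = Red)) \<or>
      (\<exists>C. eo_copy C (biclique_eo s t) (lex_graph ?E) \<and> (\<forall>e\<in>edges C. col e = Blue))"
  proof (cases "\<exists>M. ?match M \<and> m \<le> card M")
    case True
    then obtain M where M: "?match M" "m \<le> card M" by blast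
    obtain N where N: "N \<subseteq> M" "card N = m" using M(2) obtain_subset_with_card_n by metis
    then have "eo_copy (lex_graph N) (matching_eo m) (lex_graph ?E)"
      using eo_copy_matching[OF E E2, of N] M(1) pairwise_subset by blast
    then show ?thesis using N M(1) by (intro disjI1 exI[of _ "lex_graph N"]) auto
  next
    case False
    have finM: "finite {M. ?match M}"
      by (rule finite_subset[of _ "Pow ?E"]) (use E in auto)
    have "{} \<in> {M. ?match M}" by simp
    then have "\<exists>M\<in>{M. ?match M}. \<forall>N\<in>{M. ?match M}. M \<subseteq> N \<longrightarrow> M = N"
      using finM by (intro finite_has_maximal) (rule finM, blast)
    then obtain M where "M \<in> {M. ?match M}"
      and max': "\<forall>N\<in>{M. ?match M}. M \<subseteq> N \<longrightarrow> M = N" by (rule bexE)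
    then have M: "?match M" by simp
    have max: "N = M" if "?match N" "M \<subseteq> N" for N
      using bspec[OF max', of N] that by simp
    have "M \<subseteq> ?E" using M by blast
    then have "finite M" using E by (rule finite_subset)
    have "\<not> m \<le> card M" using False M by blast
    then have "card M \<le> m - 1" by simp
    have side: "card (\<Union>M \<inter> X) \<le> card M" if X: "X = A \<or> X = B" for X
    proof -
      have "card (e \<inter> X) \<le> 1" if "e \<in> M" for e
      proof -
        have "e \<in> ?E" using \<open>M \<subseteq> ?E\<close> that by blast
        then obtain a b where "a \<in> A" "b \<in> B" "e = {a, b}" unfolding cross_def by blast
        then have "e \<inter> X \<subseteq> {a} \<or> e \<inter> X \<subseteq> {b}" using X AB by auto
        then show ?thesis
          by (metis card.empty card_mono finite.intros is_singletonI is_singleton_altdef)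
      qed
      then have sum: "(\<Sum>e\<in>M. card (e \<inter> X)) \<le> card M"
        using sum_bounded_above[of M "\<lambda>e. card (e \<inter> X)" 1] by simp
      have "card (\<Union>M \<inter> X) = card (\<Union>e\<in>M. e \<inter> X)" by (simp only: Int_Union2)
      also have "\<dots> \<le> (\<Sum>e\<in>M. card (e \<inter> X))" using \<open>finite M\<close> by (rule card_UN_le)
      also note sum
      finally show ?thesis .
    qed
    have rest: "n \<le> card (X - \<Union>M)" if "X = A \<or> X = B" "m - 1 + n \<le> card X" for X n
    proof -
      have "card (X - \<Union>M) = card X - card (X \<inter> \<Union>M)"
        using that(1) fin by (intro card_Diff_subset_Int) auto
      then show ?thesis
        using side[OF that(1)] \<open>card M \<le> m - 1\<close> that(2) by (simp add: Int_commute)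
    qed
    obtain A' where A': "A' \<subseteq> A - \<Union>M" "card A' = s"
      using rest[of A s] card(1) obtain_subset_with_card_n by metis
    obtain B' where B': "B' \<subseteq> B - \<Union>M" "card B' = t"
      using rest[of B t] card(2) obtain_subset_with_card_n by metis
    have sub: "cross A' B' \<subseteq> ?E" using A' B' by (auto simp: cross_def)
    have "col e = Blue" if e: "e \<in> cross A' B'" for e
    proof (rule ccontr)
      assume "col e \<noteq> Blue"
      then have "col e = Red" by (metis colour.exhaust)
      have disj: "e \<inter> \<Union>M = {}" "e \<noteq> {}" using e A' B' by (auto simp: cross_def)
      have "?match (insert e M)"
        using M sub e \<open>col e = Red\<close> disj by (auto simp: pairwise_insert disjnt_def)
      then have "e \<in> M" using max[of "insert e M"] by blast
      then show False using disj by blast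
    qed
    moreover have "eo_copy (lex_graph (cross A' B')) (biclique_eo (card A') (card B')) (lex_graph ?E)"
    proof (rule eo_copy_biclique[OF E E2])
      show "finite A'" "finite B'" using A'(1) B'(1) fin by (auto intro: finite_subset)
      show "A' \<noteq> {}" "B' \<noteq> {}" using A'(2) B'(2) st by auto
      show "a < b" if "a \<in> A'" "b \<in> B'" for a b using that A'(1) B'(1) less by blast
    qed (use sub in auto)
    ultimately show ?thesis using A' B' by auto
  qed
qed

lemma ex_arrowing_biclique:
  assumes "1 \<le> s" "1 \<le> t"
  shows "\<exists>F :: nat eograph. edge_ordered_graph F \<and>
    card (edges F) = (m - 1 + s) * (m - 1 + t) \<and>
    eo_arrows F (matching_eo m) (biclique_eo s t)"
proof -
  let ?a = "m - 1 + s" and ?b = "m - 1 + t"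
  let ?A = "{..<?a}" and ?B = "{?a..<?a + ?b}"
  let ?F = "lex_graph (cross ?A ?B)"
  have AB: "?A \<inter> ?B = {}" by auto
  have "edge_ordered_graph ?F"
    by (rule edge_ordered_lex_graph) (use AB card_edge_cross in auto)
  moreover have "card (edges ?F) = ?a * ?b" using card_cross[OF AB] by simp
  moreover have "eo_arrows ?F (matching_eo m) (biclique_eo s t)"
    by (rule arrows_large_biclique) (use assms in auto)
  ultimately show ?thesis by blast
qed

lemma size_eo_ramsey_le_biclique:
  assumes "1 \<le> s" "1 \<le> t"
  shows "size_eo_ramsey (matching_eo m) (biclique_eo s t) \<le> (m - 1 + s) * (m - 1 + t)"
  using ex_arrowing_biclique[OF assms, of m] size_eo_ramsey_le by metis

section \<open>The Ramsey number\<close>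

text \<open>
  An infimum over an empty set would be \<open>0\<close>, so a lower bound on all arrowing graphs gives one on the
  Ramsey number only because an arrowing graph exists.
\<close>
lemma size_eo_ramsey_ge:
  assumes "1 \<le> m" "1 \<le> s" "1 \<le> t"
  shows "(m - 1 + s) * t \<le> size_eo_ramsey (matching_eo m) (biclique_eo s t)"
proof -
  let ?S = "{N. \<exists>F :: nat eograph. edge_ordered_graph F \<and> card (edges F) = N \<and>
    eo_arrows F (matching_eo m) (biclique_eo s t)}"
  have "?S \<noteq> {}" using ex_arrowing_biclique[OF assms(2,3), of m] by blast
  then have "Inf ?S \<in> ?S" by (rule Inf_nat_def1)
  then obtain F :: "nat eograph" where F: "edge_ordered_graph F" "card (edges F) = Inf ?S"
    "eo_arrows F (matching_eo m) (biclique_eo s t)" by blast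
  show ?thesis
    using card_edges_arrowing[OF F(1,3) assms(1,2)] F(2) unfolding size_eo_ramsey_def by simp
qed

lemma lower_bd_le_size_eo_ramsey:
  assumes m: "3 \<le> m" and s: "1 \<le> s" and t: "s \<le> t"
    and c: "t \<ge> m \<and> c = t + m - 1 \<or> t \<le> m \<and> c = 2 * m - 2"
  shows "lower_bd c m s t \<le> int (size_eo_ramsey (matching_eo m) (biclique_eo s t))"
proof -
  let ?r = "size_eo_ramsey (matching_eo m) (biclique_eo s t)"
  define n where "n = m - 1"
  have n: "m = Suc n" using m n_def by simp
  have "(n + s) * t \<le> ?r"
    using size_eo_ramsey_ge[of m s t] m s t n_def by simp
  then have r: "n * t + s * t \<le> ?r" by (simp add: algebra_simps)
  have "n * 1 \<le> n * t" "1 * 1 \<le> s * t" using s t by (intro mult_le_mono; linarith)+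
  then have "m \<le> ?r" using r n by linarith
  moreover have "int (s * t) \<le> int ?r" using r by (subst of_nat_le_iff) simp
  moreover have "c * s \<le> ?r + (n choose 2)"
    using c
  proof
    assume "t \<ge> m \<and> c = t + m - 1"
    then have "c * s = s * t + n * s" using n by (simp add: algebra_simps)
    also have "\<dots> \<le> s * t + n * t" using t by simp
    finally show ?thesis using r by simp
  next
    assume "t \<le> m \<and> c = 2 * m - 2"
    then have c_eq: "c = 2 * n" using n by simp
    have sq: "k \<le> k * k" for k :: int
      by (cases "k \<le> 0") (auto intro: order_trans[OF _ zero_le_square] simp: mult_le_cancel_left1)
    have "2 * (n choose 2) = n * (n - 1)"
      unfolding choose_two by (rule dvd_mult_div_cancel) (cases "even n"; simp)
    then have "2 * (n choose 2) + n = n * n" by (cases n) auto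
    then have "2 * int (n choose 2) + int n = int n * int n"
      by (metis of_nat_add of_nat_mult of_nat_numeral)
    \<comment> \<open>Twice the claim for \<open>t = s\<close>; it amounts to \<open>n \<le> (n - s)\<^sup>2 + s\<^sup>2\<close>.\<close>
    then have "2 * (2 * int n * int s) \<le> 2 * (int n * int s + int s * int s + int (n choose 2))"
      using sq[of "int n - int s"] sq[of "int s"] by (simp add: algebra_simps)
    then have "int (2 * n * s) \<le> int (n * s + s * s + (n choose 2))" by simp
    then have "2 * n * s \<le> n * s + s * s + (n choose 2)" by (simp only: of_nat_le_iff)
    also have "\<dots> \<le> n * t + s * t + (n choose 2)" using t by (simp add: add_mono)
    finally show ?thesis using r c_eq by simp
  qed
  then have "int (c * s) - int (n choose 2) \<le> int ?r" by linarith
  moreover have "m - 1 = n" using n by simp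
  ultimately show ?thesis unfolding lower_bd_def
    by simp
qed

lemma size_eo_ramsey_le_upper_bd:
  assumes "1 \<le> m" "1 \<le> s" "1 \<le> t"
  shows "int (size_eo_ramsey (matching_eo m) (biclique_eo s t)) \<le> upper_bd m s t"
proof -
  let ?r = "size_eo_ramsey (matching_eo m) (biclique_eo s t)"
  have "int ?r \<le> int (m * (s * t))"
    using size_eo_ramsey_le_copies[OF assms(2,3), of m] by (simp only: of_nat_le_iff)
  moreover have "int ?r \<le> int ((m - 1 + s) * (m - 1 + t))"
    using size_eo_ramsey_le_biclique[OF assms(2,3), of m] by (simp only: of_nat_le_iff)
  moreover have "int ((m - 1 + s) * (m - 1 + t)) =
      (int m)\<^sup>2 + int m * (int s + int t - 2) + (int s - 1) * (int t - 1)"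
    using assms(1) by (simp add: of_nat_diff) (simp add: algebra_simps power2_eq_square)
  ultimately show ?thesis unfolding upper_bd_def by (simp add: mult.assoc)
qed

theorem theorem3p5:
  "(\<forall>m s t :: nat. m \<ge> 3 \<and> s \<ge> 1 \<and> t \<ge> s \<longrightarrow>
      (t \<ge> m \<longrightarrow>
         lower_bd (t + m - 1) m s t \<le> int (size_eo_ramsey (matching_eo m) (biclique_eo s t))) \<and>
      (t \<le> m \<longrightarrow>
         lower_bd (2 * m - 2) m s t \<le> int (size_eo_ramsey (matching_eo m) (biclique_eo s t))) \<and>
      int (size_eo_ramsey (matching_eo m) (biclique_eo s t)) \<le> upper_bd m s t) \<and>
   (\<exists>m s t c :: nat. m \<ge> 3 \<and> s \<ge> 1 \<and> t \<ge> s \<and>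
      (t \<ge> m \<and> c = t + m - 1 \<or> t \<le> m \<and> c = 2 * m - 2) \<and>
      int (size_eo_ramsey (matching_eo m) (biclique_eo s t)) = lower_bd c m s t) \<and>
   (\<exists>m s t :: nat. m \<ge> 3 \<and> s \<ge> 1 \<and> t \<ge> s \<and>
      int (size_eo_ramsey (matching_eo m) (biclique_eo s t)) = upper_bd m s t)"
proof -
  let ?r = "\<lambda>m s t. int (size_eo_ramsey (matching_eo m) (biclique_eo s t))"
  have lower: "lower_bd c m s t \<le> ?r m s t"
    if "m \<ge> 3" "s \<ge> 1" "t \<ge> s" "t \<ge> m \<and> c = t + m - 1 \<or> t \<le> m \<and> c = 2 * m - 2"
    for m s t c :: nat
    using that by (rule lower_bd_le_size_eo_ramsey)
  have upper: "?r m s t \<le> upper_bd m s t" if "m \<ge> 3" "s \<ge> 1" "t \<ge> s" for m s t :: nat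
    using that by (intro size_eo_ramsey_le_upper_bd) auto
  have bds: "lower_bd 4 3 1 1 = 3" "upper_bd 3 1 1 = 3"
    by (simp_all add: lower_bd_def upper_bd_def power2_eq_square)
  then have "?r 3 1 1 = 3"
    using lower[of 3 1 1 4] upper[of 3 1 1] by simp
  then have "(3::nat) \<ge> 3 \<and> (1::nat) \<ge> 1 \<and> (1::nat) \<ge> 1 \<and>
      ((1::nat) \<ge> 3 \<and> (4::nat) = 1 + 3 - 1 \<or> (1::nat) \<le> 3 \<and> (4::nat) = 2 * 3 - 2) \<and>
      ?r 3 1 1 = lower_bd 4 3 1 1" "?r 3 1 1 = upper_bd 3 1 1"
    using bds by simp_all
  note sharp = this
  show ?thesis
  proof (intro conjI)
    show "\<exists>m s t c :: nat. m \<ge> 3 \<and> s \<ge> 1 \<and> t \<ge> s \<and>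
      (t \<ge> m \<and> c = t + m - 1 \<or> t \<le> m \<and> c = 2 * m - 2) \<and> ?r m s t = lower_bd c m s t"
      using sharp(1) by blast
    show "\<exists>m s t :: nat. m \<ge> 3 \<and> s \<ge> 1 \<and> t \<ge> s \<and> ?r m s t = upper_bd m s t"
      using sharp(2) by (metis order_refl)
  qed (use lower upper in blast)
qed

end
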